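(* Let $f$ and $g$ be meromorphic functions on the whole complex plane, and let $n$ be a positive integer. Suppose there exists a sequence of admissible rectangular contours $C_i$ tending to infinity such that, for an arbitrary complex number $a$ not coinciding with any zero or pole of $f$ and $g$, $$\int_{C_i}\frac{1}{(z-a)^{n+1}}\ln(f(z))\,dz\to 0\quad\text{and}\quad \int_{C_i}\frac{1}{(z-a)^{n+1}}\ln(g(z))\,dz\to 0\qquad (i\to\infty).$$ Suppose also that the poles and zeroes of $f$ and $g$, taking into account their multiplicities, coincide. Then $$\frac{d^n\ln(f(z))}{dz^n}=\frac{d^n\ln(g(z))}{dz^n}.$$
   Context: An admissible contour $C$ is the boundary of a rectangle bounded by the lines $x=X_1$, $x=X_2$, $y=Y_1$, $y=Y_2$ with $X_1<X_2$, $Y_1<Y_2$ (where $z=x+iy$), such that $f$ and $g$ are analytic and non-zero on $C$. A sequence of such contours tends to infinity if $X_1,Y_1\to-\infty$ and $X_2,Y_2\to+\infty$ along the sequence. In a contour integral over $C$, the logarithm $\ln(f(z))$ is defined as follows: one starts with a particular (continuous) determination of $\ln f$ on the side $x=X_2$, and obtains the value at other points by continuous variation along $y=\mathrm{const}$ from the value $\ln(f(X_2+iy))$. If this path would cross a zero or pole of $f$, one takes the value to be the limit at $z\pm i0$, according to whether the path is approached from above or below. The same convention is used for $\ln(g(z))$. The $n$-th derivative of $\ln f$ (for $n\ge 1$) is the $(n-1)$-st derivative of the meromorphic function $f'/f$, so it does not depend on the choice of branch; the conclusion is an equality at all points that are not zeroes or poles of $f$ and $g$. *)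

theory Defs
  imports "HOL-Complex_Analysis.Complex_Analysis"
begin

text \<open>
  Meromorphic functions are rendered by \<^const>\<open>nicely_meromorphic_on\<close>: all removable
  singularities are removed, and the function takes the dummy value 0 at its poles. This
  is why poles have to be excluded explicitly from the zeroes.
\<close>

definition poles_of :: "(complex \<Rightarrow> complex) \<Rightarrow> complex set" where
  "poles_of f = {z. is_pole f z}"

definition zeros_of :: "(complex \<Rightarrow> complex) \<Rightarrow> complex set" where
  "zeros_of f = {z. f z = 0 \<and> \<not> is_pole f z}"

text \<open>
  A rectangular contour is given by its lower left corner \<open>p\<close> and its upper right corner \<open>q\<close>,
  that is, \<open>p = X\<^sub>1 + i Y\<^sub>1\<close> and \<open>q = X\<^sub>2 + i Y\<^sub>2\<close>.
\<close>

definition admissible_contour ::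
    "(complex \<Rightarrow> complex) \<Rightarrow> (complex \<Rightarrow> complex) \<Rightarrow> complex \<Rightarrow> complex \<Rightarrow> bool" where
  "admissible_contour f g p q \<longleftrightarrow>
     Re p < Re q \<and> Im p < Im q \<and>
     f analytic_on path_image (rectpath p q) \<and> g analytic_on path_image (rectpath p q) \<and>
     (\<forall>z\<in>path_image (rectpath p q). f z \<noteq> 0 \<and> g z \<noteq> 0)"

definition contours_tend_to_infinity :: "(nat \<Rightarrow> complex) \<Rightarrow> (nat \<Rightarrow> complex) \<Rightarrow> bool" where
  "contours_tend_to_infinity p q \<longleftrightarrow>
     filterlim (\<lambda>i. Re (p i)) at_bot sequentially \<and>
     filterlim (\<lambda>i. Im (p i)) at_bot sequentially \<and>
     filterlim (\<lambda>i. Re (q i)) at_top sequentially \<and>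
     filterlim (\<lambda>i. Im (q i)) at_top sequentially"

text \<open>
  \<open>L\<close> is a determination of \<open>ln f\<close> on the closed rectangle: a continuous logarithm on the right
  side, continued to the left along horizontal segments. If the segment from the right side to
  \<open>z\<close> meets a zero or pole of \<open>f\<close>, then \<open>L z\<close> is the limit from above or the limit from below.
  Either choice is allowed; on the contour this concerns only finitely many points.
\<close>

definition log_determination ::
    "(complex \<Rightarrow> complex) \<Rightarrow> complex \<Rightarrow> complex \<Rightarrow> (complex \<Rightarrow> complex) \<Rightarrow> bool" where
  "log_determination f p q L \<longleftrightarrow>
     (let R = closed_segment (Complex (Re q) (Im p)) q;
          sing = zeros_of f \<union> poles_of f
      in continuous_on R L \<and> (\<forall>w\<in>R. exp (L w) = f w) \<and>
         (\<forall>z\<in>cbox p q - sing.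
            let S = closed_segment (Complex (Re q) (Im z)) z
            in if S \<inter> sing = {}
               then continuous_on S L \<and> (\<forall>w\<in>S. exp (L w) = f w)
               else ((\<lambda>t. L (z + \<i> * of_real t)) \<longlongrightarrow> L z) (at_right 0) \<or>
                    ((\<lambda>t. L (z + \<i> * of_real t)) \<longlongrightarrow> L z) (at_left 0)))"

text \<open>
  The \<open>n\<close>-th derivative of \<open>ln f\<close>, for \<open>n \<ge> 1\<close>, as the \<open>(n - 1)\<close>-st derivative of \<open>f' / f\<close>.
\<close>

definition log_nth_deriv :: "nat \<Rightarrow> (complex \<Rightarrow> complex) \<Rightarrow> complex \<Rightarrow> complex" where
  "log_nth_deriv n f = (deriv ^^ (n - 1)) (\<lambda>z. deriv f z / f z)"

end

theory Submission
  imports Defs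
begin

text \<open>
  As \<open>f\<close> and \<open>g\<close> have the same zeroes and poles, \<open>f = g exp H\<close> for an entire function \<open>H\<close>. Up to an
  additive constant, \<open>H\<close> is the difference of the two logarithms at all but finitely many points of
  each contour, so Cauchy's formula turns the difference of the two integrals into
  \<open>2\<pi>i/n! H\<^sup>(\<^sup>n\<^sup>)(a)\<close>, which therefore vanishes.
\<close>

section \<open>Continuous functions with values in \<open>2\<pi>i\<int>\<close>\<close>

text \<open>Distinct solutions of \<open>exp w = 1\<close> lie at least 2 pi apart, so
  \<open>D\<close> has discrete range, and a continuous function with discrete range on a connected
  set is constant. This is the tool for comparing any two logarithms of the same function.\<close>

lemma exp_eq_1_imp_constant_on:
  fixes D :: "'a::topological_space \<Rightarrow> complex"
  assumes "connected S" "continuous_on S D" "\<And>x. x \<in> S \<Longrightarrow> exp (D x) = 1"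
  shows "D constant_on S"
proof (rule continuous_discrete_range_constant[OF assms(1,2)])
  fix x assume x: "x \<in> S"
  have "2 * pi \<le> norm (D y - D x)" if y: "y \<in> S" and ne: "D y \<noteq> D x" for y
  proof (rule ccontr)
    assume "\<not> 2 * pi \<le> norm (D y - D x)"
    moreover have "exp (D y) = exp (D x)" using assms(3) x y by simp
    moreover have "\<bar>Im (D y) - Im (D x)\<bar> \<le> norm (D y - D x)"
      using abs_Im_le_cmod[of "D y - D x"] by simp
    ultimately show False
      using exp_complex_eqI[of "D y" "D x"] ne by auto
  qed
  then show "\<exists>e>0. \<forall>y. y \<in> S \<and> D y \<noteq> D x \<longrightarrow> e \<le> norm (D y - D x)"
    by (intro exI[of _ "2 * pi"]) auto
qed

text \<open>\<open>D\<close> is constant on each of the finitely many gaps between points of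
  \<open>S\<close>, so \<open>c x * D x\<close> is piecewise continuous. It serves the left side of
  the contour, where a determination may jump by multiples of 2 pi i.\<close>

lemma integrable_mult_exp_eq_1:
  fixes c D :: "real \<Rightarrow> complex"
  assumes "finite S" "continuous_on {a..b} c" "continuous_on ({a<..<b} - S) D"
    and "\<And>x. x \<in> {a<..<b} - S \<Longrightarrow> exp (D x) = 1"
  shows "(\<lambda>x. c x * D x) integrable_on {a..b}"
  using assms
proof (induction S arbitrary: a b rule: finite_induct)
  case empty
  then have "D constant_on {a<..<b}"
    by (intro exp_eq_1_imp_constant_on) auto
  then obtain d where d: "\<And>x. x \<in> {a<..<b} \<Longrightarrow> D x = d"
    by (auto simp: constant_on_def)
  have "(\<lambda>x. c x * d) integrable_on {a..b}"
    using empty by (intro integrable_continuous_real continuous_intros)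
  \<comment> \<open>Nothing is known about \<open>D\<close> at the two endpoints, but two points do
    not affect integrability.\<close>
  from integrable_spike_finite[OF _ _ this, of "{a, b}"] show ?case
    using d by auto
next
  case (insert s S)
  show ?case
  proof (cases "s \<in> {a<..<b}")
    case True
    show ?thesis
    proof (rule Henstock_Kurzweil_Integration.integrable_combine[where c = s])
      show "(\<lambda>x. c x * D x) integrable_on {a..s}"
        by (rule insert.IH[OF continuous_on_subset[OF insert.prems(1)]
              continuous_on_subset[OF insert.prems(2)] insert.prems(3)]) (use True in auto)
      show "(\<lambda>x. c x * D x) integrable_on {s..b}"
        by (rule insert.IH[OF continuous_on_subset[OF insert.prems(1)]
              continuous_on_subset[OF insert.prems(2)] insert.prems(3)]) (use True in auto)
    qed (use True in auto)
  next
    case False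
    then have "{a<..<b} - insert s S = {a<..<b} - S" by auto
    then show ?thesis using insert by metis
  qed
qed

section \<open>Zeroes, poles and logarithms\<close>

text \<open>The dummy value 0 at poles turns \<open>f z = 0\<close> into the single test for a
  singularity of the logarithm. From here on zeroes and poles are told apart only by the sign of
  \<open>zorder\<close>.\<close>

lemma zeros_Un_poles_eq:
  assumes "f nicely_meromorphic_on UNIV"
  shows "zeros_of f \<union> poles_of f = {z. f z = 0}"
  using is_pole_zero_at_nicely_mero[OF assms]
  by (auto simp: zeros_of_def poles_of_def)

lemma nicely_meromorphic_analytic_nonzero:
  assumes "f nicely_meromorphic_on UNIV" "f z \<noteq> 0"
  shows "f analytic_on {z}"
  using assms is_pole_zero_at_nicely_mero nicely_meromorphic_on_imp_analytic_at by blast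

lemma sparse_zeros_nicely_meromorphic:
  assumes "f nicely_meromorphic_on UNIV" "f w \<noteq> 0"
  shows "{z. f z = 0} sparse_in UNIV"
  using nicely_meromorphic_imp_constant_or_avoid[OF assms(1), of 0] assms(2)
  by (auto simp: eventually_cosparse)

text \<open>The compact set \<open>K\<close> has positive distance \<open>e\<close> from the closed
  set of zeroes and poles. Its \<open>e\<close>-neighbourhood is open and convex, hence simply
  connected, and carries a holomorphic logarithm.\<close>

lemma holomorphic_log_near_compact_convex:
  assumes f: "f nicely_meromorphic_on UNIV"
    and K: "compact K" "convex K" "K \<noteq> {}" "\<And>z. z \<in> K \<Longrightarrow> f z \<noteq> 0"
  obtains e l where "e > 0" "l holomorphic_on (\<Union>x\<in>K. ball x e)"
    "\<And>z. z \<in> (\<Union>x\<in>K. ball x e) \<Longrightarrow> exp (l z) = f z"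
proof -
  obtain k where k: "k \<in> K" using K by auto
  have "closed {z. f z = 0}"
    using sparse_in_UNIV_imp_closed[OF sparse_zeros_nicely_meromorphic[OF f]] K k by blast
  then obtain e where e: "e > 0" "\<And>x y. x \<in> K \<Longrightarrow> f y = 0 \<Longrightarrow> e \<le> dist x y"
    using separate_compact_closed[OF K(1), of "{z. f z = 0}"] K(4) by blast
  let ?U = "\<Union>x\<in>K. ball x e"
  \<comment> \<open>Written as the Minkowski sum of \<open>K\<close> and a ball, the neighbourhood
    is convex by \<open>convex_sums\<close>.\<close>
  have U: "?U = (\<Union>x\<in>K. \<Union>y\<in>ball 0 e. {x + y})"
  proof -
    have "ball x e = (\<Union>y\<in>ball 0 e. {x + y})" for x :: complex
    proof (intro equalityI subsetI)
      fix z assume "z \<in> ball x e"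
      then have "z - x \<in> ball 0 e" "z = x + (z - x)" by (auto simp: dist_norm norm_minus_commute)
      then show "z \<in> (\<Union>y\<in>ball 0 e. {x + y})" by blast
    qed (auto simp: dist_norm)
    then show ?thesis by (intro SUP_cong refl)
  qed
  have nz: "f z \<noteq> 0" if z: "z \<in> ?U" for z
  proof -
    obtain x where "x \<in> K" "dist x z < e" using z by auto
    then show ?thesis using e(2)[of x z] by auto
  qed
  have "f analytic_on ?U"
    using nz nicely_meromorphic_analytic_nonzero[OF f] analytic_on_analytic_at by blast
  then have "f holomorphic_on ?U" by (rule analytic_imp_holomorphic)
  moreover have "convex ?U" unfolding U by (intro convex_sums K) auto
  moreover have "open ?U" by auto
  moreover have "k \<in> ?U" using k e(1) by (intro UN_I[of k]) auto
  ultimately obtain l where "l holomorphic_on ?U" "\<And>z. z \<in> ?U \<Longrightarrow> exp (l z) = f z"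
    using holomorphic_logarithm_exists[of ?U f k] nz by blast
  then show ?thesis using that e by blast
qed

text \<open>Equal orders cancel in f/g, so with its singularities removed the quotient is entire
  without zeroes and has a logarithm on the plane. The point \<open>w\<close> rules out identically
  vanishing functions.\<close>

lemma entire_log_quotient:
  assumes f: "f nicely_meromorphic_on UNIV" and g: "g nicely_meromorphic_on UNIV"
    and w: "f w \<noteq> 0" "g w \<noteq> 0"
    and same: "\<And>z. f z = 0 \<longleftrightarrow> g z = 0"
    and ord: "\<And>z. f z = 0 \<Longrightarrow> zorder f z = zorder g z"
  obtains H where "H holomorphic_on UNIV" "\<And>z. g z \<noteq> 0 \<Longrightarrow> f z = g z * exp (H z)"
proof -
  \<comment> \<open>At a common zero or pole the plain quotient is 0/0 = 0;
    \<open>remove_sings\<close> puts the limit there instead.\<close>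
  define h where "h = remove_sings (\<lambda>z. f z / g z)"
  have mf: "f meromorphic_on A" and mg: "g meromorphic_on A" for A
    using f g meromorphic_on_subset unfolding nicely_meromorphic_on_def by blast+
  have h: "h nicely_meromorphic_on UNIV"
    unfolding h_def by (intro remove_sings_nicely_meromorphic meromorphic_intros mf mg)
  have h_eq: "h analytic_on {z}" "h z = f z / g z" if "g z \<noteq> 0" for z
  proof -
    have "(\<lambda>z. f z / g z) analytic_on {z}"
      using that same
      by (intro analytic_intros nicely_meromorphic_analytic_nonzero[OF f]
            nicely_meromorphic_analytic_nonzero[OF g]) auto
    then show "h analytic_on {z}" "h z = f z / g z"
      unfolding h_def by (auto intro: remove_sings_analytic_on)
  qed
  have ev: "\<forall>\<^sub>F x in at z. f x \<noteq> 0" "\<forall>\<^sub>F x in at z. g x \<noteq> 0" for z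
    using sparse_zeros_nicely_meromorphic[OF f w(1)] sparse_zeros_nicely_meromorphic[OF g w(2)]
    by (auto simp: sparse_in_eventually_iff eventually_cosparse
          intro!: eventually_cosparse_imp_eventually_at[where A = UNIV and B = UNIV])
  have ev_h: "\<forall>\<^sub>F x in at z. h x \<noteq> 0" for z
    using ev(2)[of z] by eventually_elim (use h_eq same in auto)
  have ord_h: "zorder h z = 0" if "g z = 0" for z
  proof -
    have "zorder h z = zorder (\<lambda>z. f z / g z) z"
    proof (rule zorder_cong)
      show "\<forall>\<^sub>F x in at z. h x = f x / g x"
        using ev(2)[of z] by eventually_elim (use h_eq in auto)
    qed simp
    also have "\<dots> = zorder f z - zorder g z"
      using ev[of z] by (intro zorder_divide mf mg eventually_frequently) auto
    finally show ?thesis using ord same that by simp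
  qed
  have mh: "h meromorphic_on {z}" for z
    using h meromorphic_on_subset unfolding nicely_meromorphic_on_def by blast
  have h_good: "h analytic_on {z} \<and> h z \<noteq> 0" for z
  proof (cases "g z = 0")
    case False
    then show ?thesis using h_eq same by auto
  next
    case True
    \<comment> \<open>A pole would have negative order and an isolated zero positive order; the
      order of \<open>h\<close> at \<open>z\<close> is 0.\<close>
    have "\<not> is_pole h z"
      using ord_h[OF True] isolated_pole_imp_neg_zorder[of h z] mh[of z]
      by (auto simp: meromorphic_at_iff)
    moreover from this have "h z \<noteq> 0"
      using zero_or_pole[OF h _ _ ev_h] zorder_isolated_zero_pos'[of h z] mh[of z] ord_h[OF True]
      by (auto simp: meromorphic_at_iff)
    ultimately show ?thesis using h nicely_meromorphic_on_imp_analytic_at by blast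
  qed
  then have "h holomorphic_on UNIV"
    by (meson analytic_imp_holomorphic analytic_on_analytic_at)
  then obtain H where H: "H holomorphic_on UNIV" "\<And>z. exp (H z) = h z"
    using holomorphic_logarithm_exists[of UNIV h 0] h_good by auto
  have "f z = g z * exp (H z)" if "g z \<noteq> 0" for z
    using that H h_eq by simp
  then show ?thesis using that H by blast
qed

section \<open>Determinations of the logarithm along horizontal segments\<close>

lemma log_determinationD:
  assumes "log_determination f p q L" "f nicely_meromorphic_on UNIV"
  shows "continuous_on (closed_segment (Complex (Re q) (Im p)) q) L"
    and "\<And>w. w \<in> closed_segment (Complex (Re q) (Im p)) q \<Longrightarrow> exp (L w) = f w"
    and "\<And>z. z \<in> cbox p q \<Longrightarrow> (\<And>w. w \<in> closed_segment (Complex (Re q) (Im z)) z \<Longrightarrow> f w \<noteq> 0) \<Longrightarrow>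
           continuous_on (closed_segment (Complex (Re q) (Im z)) z) L"
    and "\<And>z w. z \<in> cbox p q \<Longrightarrow> (\<And>w. w \<in> closed_segment (Complex (Re q) (Im z)) z \<Longrightarrow> f w \<noteq> 0) \<Longrightarrow>
           w \<in> closed_segment (Complex (Re q) (Im z)) z \<Longrightarrow> exp (L w) = f w"
proof -
  note L = assms(1)[unfolded log_determination_def Let_def zeros_Un_poles_eq[OF assms(2)]]
  show "continuous_on (closed_segment (Complex (Re q) (Im p)) q) L"
    using L by blast
  show "exp (L w) = f w" if "w \<in> closed_segment (Complex (Re q) (Im p)) q" for w
    using L that by blast
  have *: "continuous_on (closed_segment (Complex (Re q) (Im z)) z) L \<and>
           (\<forall>w\<in>closed_segment (Complex (Re q) (Im z)) z. exp (L w) = f w)"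
    if "z \<in> cbox p q" "\<And>w. w \<in> closed_segment (Complex (Re q) (Im z)) z \<Longrightarrow> f w \<noteq> 0" for z
  proof -
    have "z \<in> cbox p q - {z. f z = 0}" using that by auto
    moreover have "closed_segment (Complex (Re q) (Im z)) z \<inter> {z. f z = 0} = {}" using that by auto
    ultimately show ?thesis using L by presburger
  qed
  show "continuous_on (closed_segment (Complex (Re q) (Im z)) z) L"
    if "z \<in> cbox p q" "\<And>w. w \<in> closed_segment (Complex (Re q) (Im z)) z \<Longrightarrow> f w \<noteq> 0" for z
    using *[OF that] by blast
  show "exp (L w) = f w"
    if "z \<in> cbox p q" "\<And>w. w \<in> closed_segment (Complex (Re q) (Im z)) z \<Longrightarrow> f w \<noteq> 0"
      "w \<in> closed_segment (Complex (Re q) (Im z)) z" for z w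
    using *[OF that(1,2)] that(3) by blast
qed

text \<open>
  Near a horizontal segment free of zeroes and poles, \<open>f\<close> has a holomorphic logarithm \<open>l\<close>, and
  \<open>L - l\<close> is constant along horizontal segments; hence \<open>L\<close> inherits continuity from the right side.
\<close>

lemma isCont_log_determination_left:
  assumes f: "f nicely_meromorphic_on UNIV" and L: "log_determination f p q L"
    and pq: "Re p < Re q" and y0: "Im p < y0" "y0 < Im q"
    and nz: "\<And>x. Re p \<le> x \<Longrightarrow> x \<le> Re q \<Longrightarrow> f (Complex x y0) \<noteq> 0"
  shows "isCont (\<lambda>y. L (Complex (Re p) y)) y0"
proof -
  note LD = log_determinationD[OF L f]
  let ?K = "closed_segment (Complex (Re q) y0) (Complex (Re p) y0)"
  have K: "z \<in> ?K \<longleftrightarrow> Im z = y0 \<and> Re p \<le> Re z \<and> Re z \<le> Re q" for z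
    using pq by (auto simp: closed_segment_same_Im closed_segment_eq_real_ivl)
  have "f z \<noteq> 0" if "z \<in> ?K" for z
    using that nz[of "Re z"] by (cases z) (auto simp: K)
  then obtain e l where e: "e > 0" and l: "l holomorphic_on (\<Union>x\<in>?K. ball x e)"
    "\<And>z. z \<in> (\<Union>x\<in>?K. ball x e) \<Longrightarrow> exp (l z) = f z"
    by (rule holomorphic_log_near_compact_convex[OF f, of ?K, rotated 3]) auto
  let ?U = "\<Union>x\<in>?K. ball x e"
  have U: "Complex x y \<in> ?U" if "Re p \<le> x" "x \<le> Re q" "\<bar>y - y0\<bar> < e" for x y
  proof -
    have "dist (Complex x y0) (Complex x y) < e"
      using that by (simp add: dist_norm cmod_def abs_minus_commute)
    then show ?thesis using K[of "Complex x y0"] that by auto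
  qed
  \<comment> \<open>Heights so close to \<open>y0\<close> that the whole horizontal segment stays
    inside the domain \<open>?U\<close> of \<open>l\<close>.\<close>
  define T where "T = {Im p<..<Im q} \<inter> {y0 - e<..<y0 + e}"
  have eq: "L (Complex (Re p) y) = l (Complex (Re p) y) +
      (L (Complex (Re q) y) - l (Complex (Re q) y))" if y: "y \<in> T" for y
  proof -
    let ?S = "closed_segment (Complex (Re q) y) (Complex (Re p) y)"
    have SU: "?S \<subseteq> ?U"
    proof
      fix z assume "z \<in> ?S"
      then have "Im z = y" "Re p \<le> Re z" "Re z \<le> Re q"
        using pq by (auto simp: closed_segment_same_Im closed_segment_eq_real_ivl)
      then show "z \<in> ?U" using U[of "Re z" y] y by (cases z) (auto simp: T_def)
    qed
    \<comment> \<open>On \<open>?U\<close> the function \<open>f\<close> is an exponential, so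
      nearby horizontal segments avoid zeroes and poles too.\<close>
    have nzS: "f w \<noteq> 0" if "w \<in> ?S" for w
      using l(2)[of w] SU that by (metis exp_not_eq_zero subsetD)
    have box: "Complex (Re p) y \<in> cbox p q"
      using y pq by (auto simp: T_def in_cbox_complex_iff)
    have "(\<lambda>z. L z - l z) constant_on ?S"
    proof (rule exp_eq_1_imp_constant_on)
      show "continuous_on ?S (\<lambda>z. L z - l z)"
        using LD(3)[OF box] nzS holomorphic_on_imp_continuous_on[OF l(1)] SU
        by (intro continuous_on_diff) (auto intro: continuous_on_subset)
      show "exp (L z - l z) = 1" if "z \<in> ?S" for z
        using LD(4)[OF box, of z] l(2)[OF subsetD[OF SU that]] nzS that by (simp add: exp_diff)
    qed auto
    then have "L (Complex (Re p) y) - l (Complex (Re p) y) =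
        L (Complex (Re q) y) - l (Complex (Re q) y)"
      unfolding constant_on_def by (metis ends_in_segment)
    then show ?thesis by (simp add: algebra_simps)
  qed
  have lc: "continuous_on T (\<lambda>y. l (Complex x y))" if "Re p \<le> x" "x \<le> Re q" for x
    by (rule continuous_on_compose2[OF holomorphic_on_imp_continuous_on[OF l(1)]])
       (use U that in \<open>auto intro!: continuous_intros simp: T_def Complex_eq\<close>)
  have Lc: "continuous_on T (\<lambda>y. L (Complex (Re q) y))"
    by (rule continuous_on_compose2[OF LD(1)])
       (auto intro!: continuous_intros
          simp: T_def Complex_eq closed_segment_same_Re closed_segment_eq_real_ivl)
  have "continuous_on T (\<lambda>y. l (Complex (Re p) y) +
      (L (Complex (Re q) y) - l (Complex (Re q) y)))"
    using pq by (intro continuous_intros lc Lc) auto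
  then have "continuous_on T (\<lambda>y. L (Complex (Re p) y))"
    by (subst continuous_on_cong[OF refl eq]) auto
  moreover have "y0 \<in> interior T"
    using y0 e by (subst interior_open) (auto simp: T_def)
  ultimately show ?thesis by (rule continuous_on_interior)
qed

section \<open>Contour integrals of logarithms\<close>

lemma finite_zeros_cbox:
  assumes "f nicely_meromorphic_on UNIV" "f w \<noteq> 0"
  shows "finite {z \<in> cbox p q. f z = 0}"
proof -
  have "finite (cbox p q \<inter> {z. f z = 0})"
    using sparse_zeros_nicely_meromorphic[OF assms]
    by (meson compact_cbox sparse_in_compact_finite sparse_in_subset subset_UNIV)
  then show ?thesis by (simp add: Int_def)
qed

text \<open>Integrability is what later allows the two contour integrals to be subtracted. On the
  right side \<open>L\<close> is continuous by definition; the bottom and top are themselves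
  horizontal paths free of zeroes and poles. Only on the left side can \<open>L\<close> jump, at
  finitely many heights.\<close>

lemma contour_integrable_log_determination:
  assumes f: "f nicely_meromorphic_on UNIV" and L: "log_determination f p q L"
    and pq: "Re p < Re q" "Im p < Im q"
    and nz: "\<And>z. z \<in> path_image (rectpath p q) \<Longrightarrow> f z \<noteq> 0"
    and k: "continuous_on (path_image (rectpath p q)) k"
  shows "(\<lambda>z. k z * L z) contour_integrable_on rectpath p q"
proof -
  note LD = log_determinationD[OF L f]
  define a2 a4 where a24: "a2 = Complex (Re q) (Im p)" "a4 = Complex (Re p) (Im q)"
  note pir = path_image_rectpath[of p q]
  have sub: "closed_segment p a2 \<subseteq> path_image (rectpath p q)"
    "closed_segment a2 q \<subseteq> path_image (rectpath p q)"
    "closed_segment q a4 \<subseteq> path_image (rectpath p q)"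
    "closed_segment p a4 \<subseteq> path_image (rectpath p q)"
    using pq by (auto simp: pir a24 closed_segment_same_Re closed_segment_same_Im
        closed_segment_eq_real_ivl)
  have kc: "continuous_on S k" if "S \<subseteq> path_image (rectpath p q)" for S
    using k that continuous_on_subset by blast
  have 1: "(\<lambda>z. k z * L z) contour_integrable_on linepath p a2"
  proof (intro contour_integrable_continuous_linepath continuous_on_mult kc sub)
    have "continuous_on (closed_segment (Complex (Re q) (Im p)) p) L"
      by (rule LD(3)) (use pq nz sub in \<open>auto simp: in_cbox_complex_iff a24 closed_segment_commute\<close>)
    then show "continuous_on (closed_segment p a2) L" by (simp add: a24 closed_segment_commute)
  qed
  have 2: "(\<lambda>z. k z * L z) contour_integrable_on linepath a2 q"
    using LD(1) a24
    by (intro contour_integrable_continuous_linepath continuous_on_mult kc sub) simp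
  have 3: "(\<lambda>z. k z * L z) contour_integrable_on linepath q a4"
  proof (intro contour_integrable_continuous_linepath continuous_on_mult kc sub)
    have q: "Complex (Re q) (Im a4) = q" by (simp add: a24)
    have "continuous_on (closed_segment (Complex (Re q) (Im a4)) a4) L"
      by (rule LD(3), unfold q) (use pq nz sub in \<open>auto simp: in_cbox_complex_iff a24\<close>)
    then show "continuous_on (closed_segment q a4) L" by (simp add: q)
  qed
  \<comment> \<open>The left side is treated upwards, as an integral over y, and reversed at the
    end. There \<open>L\<close> splits into a continuous logarithm \<open>l\<close> and a remainder
    \<open>D\<close> with values in 2 pi i times the integers.\<close>
  have 4: "(\<lambda>z. k z * L z) contour_integrable_on linepath p a4"
  proof -
    have seg: "z \<in> closed_segment p a4 \<longleftrightarrow> Re z = Re p \<and> Im p \<le> Im z \<and> Im z \<le> Im q" for z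
      using pq by (auto simp: a24 closed_segment_same_Re closed_segment_eq_real_ivl)
    obtain e l where e: "e > 0" and l: "l holomorphic_on (\<Union>x\<in>closed_segment p a4. ball x e)"
      "\<And>z. z \<in> (\<Union>x\<in>closed_segment p a4. ball x e) \<Longrightarrow> exp (l z) = f z"
      by (rule holomorphic_log_near_compact_convex[OF f, of "closed_segment p a4"])
         (use nz sub in auto)
    have U: "closed_segment p a4 \<subseteq> (\<Union>x\<in>closed_segment p a4. ball x e)"
      using e by auto
    define Z where "Z = {z \<in> cbox p q. f z = 0}"
    define c where "c y = k (Complex (Re p) y)" for y
    define D where "D y = L (Complex (Re p) y) - l (Complex (Re p) y)" for y
    have comp: "continuous_on {Im p..Im q} (\<lambda>y. u (Complex (Re p) y))"
      if "continuous_on (closed_segment p a4) u" for u :: "complex \<Rightarrow> complex"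
      by (rule continuous_on_compose2[OF that])
         (auto intro!: continuous_intros simp: seg Complex_eq)
    have c: "continuous_on {Im p..Im q} c"
      unfolding c_def by (intro comp kc sub)
    have lc: "continuous_on {Im p..Im q} (\<lambda>y. l (Complex (Re p) y))"
      using holomorphic_on_imp_continuous_on[OF l(1)] U
      by (intro comp) (auto intro: continuous_on_subset)
    \<comment> \<open>The exceptional heights are those of the zeroes and poles \<open>Z\<close> in
      the rectangle: at any other height the horizontal path from the right side is
      unobstructed.\<close>
    have int: "(\<lambda>y. c y * D y) integrable_on {Im p..Im q}"
    proof (rule integrable_mult_exp_eq_1[where S = "Im ` Z"])
      show "finite (Im ` Z)"
        using finite_zeros_cbox[OF f, of p] nz[of p] sub(1) by (auto simp: Z_def)
      have nzZ: "f (Complex x y) \<noteq> 0"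
        if "y \<in> {Im p<..<Im q} - Im ` Z" "Re p \<le> x" "x \<le> Re q" for x y
        using that by (force simp: Z_def in_cbox_complex_iff image_iff)
      show "continuous_on ({Im p<..<Im q} - Im ` Z) D"
        unfolding D_def
      proof (intro continuous_on_diff continuous_at_imp_continuous_on ballI)
        show "isCont (\<lambda>y. L (Complex (Re p) y)) y" if "y \<in> {Im p<..<Im q} - Im ` Z" for y
          using that nzZ pq by (intro isCont_log_determination_left[OF f L]) auto
        show "isCont (\<lambda>y. l (Complex (Re p) y)) y" if "y \<in> {Im p<..<Im q} - Im ` Z" for y
          using that by (intro continuous_on_interior[OF lc]) auto
      qed
      show "exp (D y) = 1" if y: "y \<in> {Im p<..<Im q} - Im ` Z" for y
      proof -
        let ?z = "Complex (Re p) y"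
        have "f w \<noteq> 0" if "w \<in> closed_segment (Complex (Re q) (Im ?z)) ?z" for w
          using that nzZ[OF y, of "Re w"] pq
          by (cases w) (auto simp: closed_segment_same_Im closed_segment_eq_real_ivl)
        then have "exp (L ?z) = f ?z"
          using y pq by (intro LD(4)[of ?z]) (auto simp: in_cbox_complex_iff)
        moreover have "exp (l ?z) = f ?z"
          using y U by (intro l(2) subsetD[OF U]) (auto simp: seg)
        moreover have "f ?z \<noteq> 0" using nzZ[OF y] pq by auto
        ultimately show ?thesis by (simp add: D_def exp_diff)
      qed
    qed (rule c)
    have "(\<lambda>y. c y * l (Complex (Re p) y) + c y * D y) integrable_on {Im p..Im q}"
      by (intro integrable_add int integrable_continuous_real continuous_on_mult c lc)
    then have "(\<lambda>y. k (Complex (Re p) y) * L (Complex (Re p) y)) integrable_on {Im p..Im q}"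
      by (simp add: c_def D_def algebra_simps)
    then obtain I where "((\<lambda>y. k (Complex (Re p) y) * L (Complex (Re p) y)) has_integral I)
        {Im p..Im q}" by (auto simp: integrable_on_def)
    \<comment> \<open>On a vertical segment dz = i dy; the value \<open>I\<close> is rewritten to
      match the factor in the conversion rule below.\<close>
    then have "((\<lambda>y. k (Complex (Re p) y) * L (Complex (Re p) y)) has_integral - \<i> * (\<i> * I))
        {Im p..Im q}" by simp
    then have "((\<lambda>z. k z * L z) has_contour_integral \<i> * I) (linepath p a4)"
      by (subst has_contour_integral_linepath_same_Re_iff[where c = "Re p" and a = "Im p" and b = "Im q"])
         (use pq in \<open>auto simp: a24\<close>)
    then show ?thesis by (auto simp: contour_integrable_on_def)
  qed
  have "(\<lambda>z. k z * L z) contour_integrable_on linepath a4 p"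
    using contour_integrable_reversepath[OF _ 4] by simp
  then show ?thesis
    using 1 2 3 by (simp add: rectpath_def Let_def flip: a24)
qed

text \<open>\<open>Lf - Lg - H\<close> has exponential 1 wherever both determinations are true
  logarithms. It is constant on the right side, and unobstructed horizontal segments carry the same
  constant to the rest of the contour.\<close>

lemma log_determination_diff:
  assumes f: "f nicely_meromorphic_on UNIV" and g: "g nicely_meromorphic_on UNIV"
    and Lf: "log_determination f p q Lf" and Lg: "log_determination g p q Lg"
    and pq: "Re p < Re q" "Im p < Im q"
    and nz: "\<And>z. z \<in> path_image (rectpath p q) \<Longrightarrow> g z \<noteq> 0"
    and H: "H holomorphic_on UNIV" "\<And>z. g z \<noteq> 0 \<Longrightarrow> f z = g z * exp (H z)"
  obtains A c where "finite A"
    "\<And>z. z \<in> path_image (rectpath p q) - A \<Longrightarrow> Lf z - Lg z = H z + c"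
proof -
  note LfD = log_determinationD[OF Lf f] and LgD = log_determinationD[OF Lg g]
  define D where "D z = Lf z - Lg z - H z" for z
  have Hc: "continuous_on S H" for S
    using H(1) continuous_on_subset holomorphic_on_imp_continuous_on by blast
  let ?R = "closed_segment (Complex (Re q) (Im p)) q"
  have R: "z \<in> ?R \<longleftrightarrow> Re z = Re q \<and> Im p \<le> Im z \<and> Im z \<le> Im q" for z
    using pq by (auto simp: closed_segment_same_Re closed_segment_eq_real_ivl)
  have exp_D: "exp (D z) = 1" if "exp (Lf z) = f z" "exp (Lg z) = g z" for z
    using that H(2)[of z] exp_not_eq_zero[of "Lg z"] by (simp add: D_def exp_diff)
  have "D constant_on ?R"
  proof (rule exp_eq_1_imp_constant_on)
    show "continuous_on ?R D"
      unfolding D_def by (intro continuous_on_diff LfD(1) LgD(1) Hc)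
    show "exp (D z) = 1" if "z \<in> ?R" for z
      using that by (intro exp_D LfD(2) LgD(2))
  qed auto
  then obtain c where c: "\<And>z. z \<in> ?R \<Longrightarrow> D z = c"
    by (auto simp: constant_on_def)
  define Z where "Z = {z \<in> cbox p q. g z = 0}"
  \<comment> \<open>Projections of the zeroes and poles to the left side, the only contour points
    whose horizontal path can be obstructed.\<close>
  define A where "A = (\<lambda>w. Complex (Re p) (Im w)) ` Z"
  have "finite Z"
    unfolding Z_def using finite_zeros_cbox[OF g, of p] nz[of p] pq
    by (auto simp: path_image_rectpath)
  then have "finite A" by (simp add: A_def)
  moreover have "Lf z - Lg z = H z + c" if z: "z \<in> path_image (rectpath p q) - A" for z
  proof -
    let ?S = "closed_segment (Complex (Re q) (Im z)) z"
    have zb: "z \<in> cbox p q"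
      using z path_image_rectpath_subset_cbox[of p q] pq by auto
    have gS: "g w \<noteq> 0" if w: "w \<in> ?S" for w
    proof
      assume "g w = 0"
      have w': "Im w = Im z" "Re z \<le> Re w" "Re w \<le> Re q"
        using w zb by (auto simp: closed_segment_same_Im closed_segment_eq_real_ivl
            in_cbox_complex_iff split: if_splits)
      have wZ: "w \<in> Z" using w' zb \<open>g w = 0\<close> by (auto simp: Z_def in_cbox_complex_iff)
      \<comment> \<open>From a point of the right, bottom or top side the horizontal path stays on
        the contour, where \<open>g\<close> has no zero; hence \<open>z\<close> lies on the left
        side.\<close>
      have "w \<notin> path_image (rectpath p q)" using nz \<open>g w = 0\<close> by blast
      then have "Re z = Re p"
        using w' z pq zb by (auto simp: path_image_rectpath in_cbox_complex_iff)
      then have "z = Complex (Re p) (Im w)" using w' by (simp add: complex_eq_iff)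
      then show False using z wZ by (auto simp: A_def)
    qed
    have fS: "f w \<noteq> 0" if "w \<in> ?S" for w
      using gS[OF that] H(2)[of w] by simp
    have "D constant_on ?S"
    proof (rule exp_eq_1_imp_constant_on)
      show "continuous_on ?S D"
        unfolding D_def using gS fS by (intro continuous_on_diff LfD(3) LgD(3) Hc zb) auto
      show "exp (D w) = 1" if "w \<in> ?S" for w
        using that gS fS by (intro exp_D LfD(4)[OF zb] LgD(4)[OF zb]) auto
    qed auto
    then have "D z = D (Complex (Re q) (Im z))"
      unfolding constant_on_def by (metis ends_in_segment)
    also have "\<dots> = c" using zb by (intro c) (auto simp: R in_cbox_complex_iff)
    finally show ?thesis by (simp add: D_def algebra_simps)
  qed
  ultimately show ?thesis using that by blast
qed

text \<open>By the residue theorem: the winding number around \<open>a\<close> is 1, and the residue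
  there is the \<open>n\<close>-th Taylor coefficient of \<open>h\<close> at
  \<open>a\<close>.\<close>

lemma Cauchy_higher_derivative_rectpath:
  assumes "h holomorphic_on UNIV" "a \<in> box p q"
  shows "contour_integral (rectpath p q) (\<lambda>z. h z / (z - a) ^ Suc n) =
           2 * pi * \<i> / fact n * (deriv ^^ n) h a"
proof -
  have pq: "Re p < Re q" "Im p < Im q"
    using assms(2) by (auto simp: in_box_complex_iff)
  have "contour_integral (rectpath p q) (\<lambda>z. h z / (z - a) ^ Suc n) =
      2 * pi * \<i> * (\<Sum>w\<in>{a}. winding_number (rectpath p q) w *
        residue (\<lambda>z. h z / (z - a) ^ Suc n) w)"
  proof (rule Residue_theorem[where S = UNIV])
    have "h holomorphic_on (UNIV - {a})" using assms(1) holomorphic_on_subset by blast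
    then show "(\<lambda>z. h z / (z - a) ^ Suc n) holomorphic_on UNIV - {a}"
      by (intro holomorphic_intros) auto
    show "path_image (rectpath p q) \<subseteq> UNIV - {a}"
      using path_image_rectpath_inter_box[of p q] pq assms(2) by auto
  qed auto
  also have "\<dots> = 2 * pi * \<i> / fact n * (deriv ^^ n) h a"
    using assms by (simp only: sum.insert sum.empty finite.emptyI empty_iff not_False_eq_True
        winding_number_rectpath residue_holomorphic_over_power[OF open_UNIV UNIV_I assms(1)]) simp
  finally show ?thesis .
qed

lemma contour_integral_log_diff:
  assumes f: "f nicely_meromorphic_on UNIV" and g: "g nicely_meromorphic_on UNIV"
    and adm: "admissible_contour f g p q"
    and Lf: "log_determination f p q Lf" and Lg: "log_determination g p q Lg"
    and H: "H holomorphic_on UNIV" "\<And>z. g z \<noteq> 0 \<Longrightarrow> f z = g z * exp (H z)"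
    and a: "a \<in> box p q" and n: "n \<ge> 1"
  shows "contour_integral (rectpath p q) (\<lambda>z. 1 / (z - a) ^ (n + 1) * Lf z) -
         contour_integral (rectpath p q) (\<lambda>z. 1 / (z - a) ^ (n + 1) * Lg z) =
         2 * pi * \<i> / fact n * (deriv ^^ n) H a"
proof -
  have pq: "Re p < Re q" "Im p < Im q"
    and nz: "\<And>z. z \<in> path_image (rectpath p q) \<Longrightarrow> f z \<noteq> 0"
      "\<And>z. z \<in> path_image (rectpath p q) \<Longrightarrow> g z \<noteq> 0"
    using adm by (auto simp: admissible_contour_def)
  obtain A c where Ac: "finite A"
    "\<And>z. z \<in> path_image (rectpath p q) - A \<Longrightarrow> Lf z - Lg z = H z + c"
    using log_determination_diff[OF f g Lf Lg pq nz(2) H] by blast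
  let ?k = "\<lambda>z. 1 / (z - a) ^ (n + 1)"
  have "a \<notin> path_image (rectpath p q)"
    using path_image_rectpath_inter_box[of p q] pq a by auto
  then have k: "continuous_on (path_image (rectpath p q)) ?k"
    by (auto intro!: continuous_intros)
  have "contour_integral (rectpath p q) (\<lambda>z. ?k z * Lf z) -
      contour_integral (rectpath p q) (\<lambda>z. ?k z * Lg z) =
      contour_integral (rectpath p q) (\<lambda>z. ?k z * Lf z - ?k z * Lg z)"
    by (intro contour_integral_diff[symmetric] contour_integrable_log_determination[OF f Lf pq nz(1) k]
          contour_integrable_log_determination[OF g Lg pq nz(2) k])
  also have "\<dots> = contour_integral (rectpath p q) (\<lambda>z. (H z + c) / (z - a) ^ Suc n)"
  \<comment> \<open>A simple path meets the finite set \<open>A\<close> at finitely many parameters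
    only, so the values there do not change the integral.\<close>
  proof (rule contour_integral_spike_finite_simple_path[OF Ac(1)])
    fix z assume "z \<in> path_image (rectpath p q) - A"
    then have "Lf z - Lg z = H z + c" by (rule Ac(2))
    then show "?k z * Lf z - ?k z * Lg z = (H z + c) / (z - a) ^ Suc n"
      by (metis Suc_eq_plus1 mult.left_neutral right_diff_distrib times_divide_eq_left)
  qed (use pq in auto)
  also have "\<dots> = 2 * pi * \<i> / fact n * (deriv ^^ n) (\<lambda>z. H z + c) a"
    using H(1) by (intro Cauchy_higher_derivative_rectpath a holomorphic_intros)
  \<comment> \<open>Since n is at least 1, the constant \<open>c\<close>, which depends on the
    contour and the branches, disappears.\<close>
  also have "(deriv ^^ n) (\<lambda>z. H z + c) a = (deriv ^^ n) H a"
    using higher_deriv_add[OF H(1) holomorphic_on_const open_UNIV UNIV_I, of n c a] n by simp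
  finally show ?thesis .
qed

section \<open>The derivatives of the logarithm\<close>

text \<open>Logarithmic differentiation of f = g exp H gives f'/f = g'/g + H' on the open set where
  \<open>g\<close> is non-zero; it remains to differentiate n - 1 times.\<close>

lemma log_nth_deriv_mult_exp:
  assumes g: "g nicely_meromorphic_on UNIV" "g a \<noteq> 0"
    and H: "H holomorphic_on UNIV" "\<And>z. g z \<noteq> 0 \<Longrightarrow> f z = g z * exp (H z)"
    and n: "n \<ge> 1"
  shows "log_nth_deriv n f a = log_nth_deriv n g a + (deriv ^^ n) H a"
proof -
  define U where "U = {z. g z \<noteq> 0}"
  have "open U"
    using sparse_in_UNIV_imp_closed[OF sparse_zeros_nicely_meromorphic[OF g]]
    by (simp add: U_def closed_def Compl_eq)
  have "g analytic_on U"
    using nicely_meromorphic_analytic_nonzero[OF g(1)] analytic_on_analytic_at U_def by blast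
  then have gh: "g holomorphic_on U" by (rule analytic_imp_holomorphic)
  have eq: "deriv f z / f z = deriv g z / g z + deriv H z" if "z \<in> U" for z
  proof -
    have gd: "(g has_field_derivative deriv g z) (at z)"
      using gh \<open>open U\<close> that by (rule holomorphic_derivI)
    have Hd: "(H has_field_derivative deriv H z) (at z)"
      using H(1) by (rule holomorphic_derivI) auto
    have "((\<lambda>z. g z * exp (H z)) has_field_derivative
        deriv g z * exp (H z) + exp (H z) * deriv H z * g z) (at z)"
      by (rule derivative_eq_intros gd Hd refl)+
    then have "(f has_field_derivative
        deriv g z * exp (H z) + exp (H z) * deriv H z * g z) (at z)"
      by (rule has_field_derivative_transform_within_open[OF _ \<open>open U\<close> that])
         (use H(2) in \<open>auto simp: U_def\<close>)
    then have "deriv f z = deriv g z * exp (H z) + exp (H z) * deriv H z * g z"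
      by (rule DERIV_imp_deriv)
    then show ?thesis using that H(2)[of z] by (simp add: U_def field_simps)
  qed
  have a: "a \<in> U" using g by (simp add: U_def)
  have Hh: "deriv H holomorphic_on U"
    using H(1) holomorphic_deriv holomorphic_on_subset by blast
  have qh: "(\<lambda>z. deriv g z / g z) holomorphic_on U"
    using gh \<open>open U\<close> by (intro holomorphic_intros) (auto simp: U_def)
  have "(deriv ^^ (n - 1)) (\<lambda>z. deriv f z / f z) a =
      (deriv ^^ (n - 1)) (\<lambda>z. deriv g z / g z + deriv H z) a"
    using a \<open>open U\<close> eq by (intro higher_deriv_cong_ev) (auto simp: eventually_nhds)
  also have "\<dots> = (deriv ^^ (n - 1)) (\<lambda>z. deriv g z / g z) a + (deriv ^^ (n - 1)) (deriv H) a"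
    by (rule higher_deriv_add[OF qh Hh \<open>open U\<close> a])
  also have "(deriv ^^ (n - 1)) (deriv H) = (deriv ^^ n) H"
    using n by (metis Suc_diff_1 funpow_Suc_right less_le_trans o_apply zero_less_one)
  finally show ?thesis by (simp add: log_nth_deriv_def)
qed

section \<open>Passage to the limit along the contours\<close>

lemma eventually_in_box_contours:
  assumes "contours_tend_to_infinity p q"
  shows "\<forall>\<^sub>F i in sequentially. a \<in> box (p i) (q i)"
proof -
  note * = assms[unfolded contours_tend_to_infinity_def]
  have "\<forall>\<^sub>F i in sequentially. Re (p i) < Re a" "\<forall>\<^sub>F i in sequentially. Im (p i) < Im a"
    "\<forall>\<^sub>F i in sequentially. Re a < Re (q i)" "\<forall>\<^sub>F i in sequentially. Im a < Im (q i)"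
    using * by (auto simp: filterlim_at_bot_dense filterlim_at_top_dense)
  then show ?thesis by eventually_elim (simp add: in_box_complex_iff)
qed

theorem lemma1:
  fixes f g :: "complex \<Rightarrow> complex" and n :: nat
    and p q :: "nat \<Rightarrow> complex" and Lf Lg :: "nat \<Rightarrow> complex \<Rightarrow> complex"
  assumes "f nicely_meromorphic_on UNIV" and "g nicely_meromorphic_on UNIV"
    and "n \<ge> 1"
    and "\<And>i. admissible_contour f g (p i) (q i)"
    and "contours_tend_to_infinity p q"
    and "\<And>i. log_determination f (p i) (q i) (Lf i)"
    and "\<And>i. log_determination g (p i) (q i) (Lg i)"
    and "\<And>a. a \<notin> zeros_of f \<union> poles_of f \<union> zeros_of g \<union> poles_of g \<Longrightarrow>
           (\<lambda>i. contour_integral (rectpath (p i) (q i)) (\<lambda>z. 1 / (z - a) ^ (n + 1) * Lf i z))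
             \<longlonglongrightarrow> 0"
    and "\<And>a. a \<notin> zeros_of f \<union> poles_of f \<union> zeros_of g \<union> poles_of g \<Longrightarrow>
           (\<lambda>i. contour_integral (rectpath (p i) (q i)) (\<lambda>z. 1 / (z - a) ^ (n + 1) * Lg i z))
             \<longlonglongrightarrow> 0"
    and "zeros_of f = zeros_of g" and "poles_of f = poles_of g"
    and "\<And>z. z \<in> zeros_of f \<union> poles_of f \<Longrightarrow> zorder f z = zorder g z"
  shows "\<forall>z. z \<notin> zeros_of f \<union> poles_of f \<union> zeros_of g \<union> poles_of g \<longrightarrow>
           log_nth_deriv n f z = log_nth_deriv n g z"
proof (intro allI impI)
  fix a assume a: "a \<notin> zeros_of f \<union> poles_of f \<union> zeros_of g \<union> poles_of g"
  note f = assms(1) and g = assms(2) and n = assms(3)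
  note sing = zeros_Un_poles_eq[OF f] zeros_Un_poles_eq[OF g]
  have anz: "f a \<noteq> 0" "g a \<noteq> 0" using a sing by blast+
  have same: "f z = 0 \<longleftrightarrow> g z = 0" for z
    using sing assms(10,11) by blast
  have ord: "zorder f z = zorder g z" if "f z = 0" for z
    using assms(12)[of z] sing(1) that by simp
  \<comment> \<open>The point \<open>a\<close> doubles as the witness that neither function vanishes
    identically.\<close>
  obtain H where H: "H holomorphic_on UNIV" "\<And>z. g z \<noteq> 0 \<Longrightarrow> f z = g z * exp (H z)"
    using entire_log_quotient[OF f g anz same ord] by blast
  let ?I = "\<lambda>L i. contour_integral (rectpath (p i) (q i)) (\<lambda>z. 1 / (z - a) ^ (n + 1) * L i z)"
  have "(\<lambda>i. ?I Lf i - ?I Lg i) \<longlonglongrightarrow> 0 - 0"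
    by (intro tendsto_diff assms(8,9) a)
  \<comment> \<open>Once the contour encloses \<open>a\<close>, the difference no longer depends on
    \<open>i\<close>; as it also tends to 0, it is 0.\<close>
  moreover have "\<forall>\<^sub>F i in sequentially. ?I Lf i - ?I Lg i = 2 * pi * \<i> / fact n * (deriv ^^ n) H a"
    using eventually_in_box_contours[OF assms(5), of a]
    by eventually_elim (intro contour_integral_log_diff[OF f g assms(4,6,7) H _ n])
  ultimately have "(\<lambda>i. 2 * pi * \<i> / fact n * (deriv ^^ n) H a) \<longlonglongrightarrow> 0"
    using tendsto_cong by fastforce
  then have "(deriv ^^ n) H a = 0"
    by (simp add: LIMSEQ_const_iff)
  then show "log_nth_deriv n f a = log_nth_deriv n g a"
    using log_nth_deriv_mult_exp[OF g anz(2) H n] by simp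
qed

end
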